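(* Consider the system, basis functions, data, data matrices and saturation function (with levels $\bar u_1,\dots,\bar u_m>0$) described in the context, and assume Assumptions (A1), (A2), (A3) stated there. Let $r>0$ be such that $\mathcal{B}_r\subseteq\mathbb{X}$, and let $\bar{\mathcal{Q}}$ be the finite vertex set defined in the context. Suppose there exist a symmetric matrix $\bar\Gamma\in\mathbb{R}^{n\times n}$ with $\bar\Gamma\succ0$, a real number $\epsilon_{\bar\Gamma}>0$, matrices $\bar Y,\bar W\in\mathbb{R}^{m\times n}$ and a diagonal positive definite matrix $\bar S\in\mathbb{R}^{m\times m}$ such that $$\begin{bmatrix}\bar\Gamma & \bar W_{(i)}^\top \\ \bar W_{(i)} & \bar u_i^2\end{bmatrix}\succeq0,\qquad i=1,\dots,m,$$ $$\begin{bmatrix}-\bar\Gamma+\epsilon_{\bar\Gamma}I_n & -\bar Y^\top-\bar W^\top & 0 & \begin{bmatrix}\bar\Gamma \\ \bar Y\end{bmatrix}^\top Q^\top \\ -\bar Y-\bar W & -2\bar S & 0 & \begin{bmatrix}0 \\ \bar S\end{bmatrix}^\top Q^\top \\ 0 & 0 & -\bar\Gamma-\mathbf{C} & -\mathbf{B} \\ Q\begin{bmatrix}\bar\Gamma \\ \bar Y\end{bmatrix} & Q\begin{bmatrix}0 \\ \bar S\end{bmatrix} & -\mathbf{B}^\top & -\mathbf{A}\end{bmatrix}\preceq0\qquad\text{for all }Q\in\bar{\mathcal{Q}} .$$ Let $u=Kx$ with $K=\bar Y\bar\Gamma^{-1}$, and let $\bar P=\bar\Gamma^{-1}$. Then $\mathcal{B}_{\bar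 r_0}\cap\mathcal{E}_{\bar P,1}$, with $$\bar r_0=\min\left\{r,\ \sqrt{\frac{\lambda_{\max}(\bar\Gamma)\lambda_{\min}(\bar\Gamma)}{\lambda_{\max}^2(\bar\Gamma)-\epsilon_{\bar\Gamma}\lambda_{\min}(\bar\Gamma)}}\cdot r\right\}$$ (the quotient being read as $+\infty$ if its denominator is $0$), is a region of attraction of the closed-loop system $x^{+}=A(x)x+B(x)\,\mathrm{sat}(Kx)$ relative to the equilibrium $0$, and this closed-loop system starting from any $x(0)\in\mathcal{B}_{\bar r_0}\cap\mathcal{E}_{\bar P,1}$ exponentially converges to the origin.
   Context: System: $n,m\ge1$; $\mathbb{X}\subseteq\mathbb{R}^n$ contains the origin; $A(x)=[a_{ij}(x)]_{n\times n}$, $B(x)=[b_{ij}(x)]_{n\times m}$ with entries continuous on $\mathbb{X}$; discrete-time system with input saturation $x^{+}=A(x)x+B(x)\,\mathrm{sat}(u)$, $x^{+}(k)=x(k+1)$, $k\in\mathbb{N}=\{0,1,2,\dots\}$, where $\mathrm{sat}:\mathbb{R}^m\to\mathbb{R}^m$ acts componentwise by $\mathrm{sat}(u_i)=\mathrm{sign}(u_i)\min(|u_i|,\bar u_i)$ with given $\bar u_i>0$. Assumption (A1): there are known functions $\xi_{A_j}:\mathbb{R}^n\to\mathbb{R}^{n_{A_j}}$ ($j=1,\dots,n$) and $\xi_{B_j}:\mathbb{R}^n\to\mathbb{R}^{n_{B_j}}$ ($j=1,\dots,m$), continuous on $\mathbb{X}$, and (unknown) constant matrices $E_{A_j}\in\mathbb{R}^{n\times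 n_{A_j}}$, $E_{B_j}\in\mathbb{R}^{n\times n_{B_j}}$ such that the $j$-th column of $A(x)$ equals $E_{A_j}\xi_{A_j}(x)$ and the $j$-th column of $B(x)$ equals $E_{B_j}\xi_{B_j}(x)$. Put $E_A=[E_{A_1}\cdots E_{A_n}]$, $E_B=[E_{B_1}\cdots E_{B_m}]$, $n_A=\sum_j n_{A_j}$, $n_B=\sum_j n_{B_j}$, $\Xi_A(x)=\mathrm{blkdiag}(\xi_{A_1}(x),\dots,\xi_{A_n}(x))$, $\Xi_B(x)=\mathrm{blkdiag}(\xi_{B_1}(x),\dots,\xi_{B_m}(x))$ (each $\xi$ a column vector block), so $A(x)=E_A\Xi_A(x)$, $B(x)=E_B\Xi_B(x)$. Data: for $k=0,\dots,T-1$ ($T\geq 1$), inputs $u_d(k)$, states $x_d(k)$ and noise $d(k)\in\mathbb{R}^n$ satisfy $x_d(k+1)=E_A\Xi_A(x_d(k))x_d(k)+E_B\Xi_B(x_d(k))u_d(k)+d(k)$. Data matrices: $X_0=[\Xi_A(x_d(0))x_d(0)\ \cdots\ \Xi_A(x_d(T-1))x_d(T-1)]$, $X_1=[x_d(1)\cdots x_d(T)]$, $U_0=[\Xi_B(x_d(0))u_d(0)\cdots\Xi_B(x_d(T-1))u_d(T-1)]$, $D_0=[d(0)\cdots d(T-1)]$, so $X_1=E_AX_0+E_BU_0+D_0$. Assumption (A2): a matrix $\Theta\succeq0$ is known with $D_0D_0^\top\preceq\Theta$. Assumption (A3): $\begin{bmatrix}X_0 \\ U_0\end{bmatrix}$ has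 full row rank. Define $\mathbf{A}=\begin{bmatrix}X_0 \\ U_0\end{bmatrix}\begin{bmatrix}X_0 \\ U_0\end{bmatrix}^\top$, $\mathbf{B}=-X_1\begin{bmatrix}X_0 \\ U_0\end{bmatrix}^\top$, $\mathbf{C}=X_1X_1^\top-\Theta$. Vertex set: let $\xi^A_{ij}$ and $\xi^B_{ij}$ be the $i$-th entries of $\xi_{A_j}$ and $\xi_{B_j}$, and let $\bar\xi^A_{ij},\underline\xi^A_{ij}$ (resp. $\bar\xi^B_{ij},\underline\xi^B_{ij}$) be the maximum and minimum of $\xi^A_{ij}$ (resp. $\xi^B_{ij}$) over $\mathcal{B}_r$. Then $\bar{\mathcal{Q}}$ is the finite set of all matrices $\mathrm{blkdiag}(\zeta_{A_1},\dots,\zeta_{A_n},\zeta_{B_1},\dots,\zeta_{B_m})\in\mathbb{R}^{(n_A+n_B)\times(n+m)}$ where $\zeta_{A_j}\in\mathbb{R}^{n_{A_j}}$ has $i$-th entry in $\{\bar\xi^A_{ij},\underline\xi^A_{ij}\}$ and $\zeta_{B_j}\in\mathbb{R}^{n_{B_j}}$ has $i$-th entry in $\{\bar\xi^B_{ij},\underline\xi^B_{ij}\}$. Notation: $|\cdot|$ is the Euclidean norm; $\mathcal{B}_r=\{x\in\mathbb{R}^n:|x|\le r\}$; $\mathcal{E}_{M,\tau}=\{x\in\mathbb{R}^n:x^\top Mx\le\tau\}$; $M_{(i)}$ is the $i$-th row of $M$; $\lambda_{\max},\lambda_{\min}$ are extreme eigenvalues of a symmetric matrix; $\succ,\succeq,\preceq$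 denote the Loewner order; in $\begin{bmatrix}0 \\ \bar S\end{bmatrix}$ the zero block is $n\times m$. A set $\mathcal{R}\subset\mathbb{R}^n$ is a region of attraction of $x^{+}=f(x)$ relative to the equilibrium $0$ if for every $x(0)\in\mathcal{R}$ the solution satisfies $\lim_{k\to\infty}x(k)=0$. Exponential convergence to the origin from a set $\mathcal{R}$ means there are constants $c>0$, $\rho\in(0,1)$ such that $|x(k)|\le c\rho^k|x(0)|$ for all $k\in\mathbb{N}$ and all $x(0)\in\mathcal{R}$. These claims include that the solution remains in $\mathbb{X}$, so that it is defined for all $k$. *)

theory Defs
  imports "HOL-Analysis.Analysis"
begin

definition psd :: "real^'n^'n \<Rightarrow> bool" where
  "psd M \<longleftrightarrow> transpose M = M \<and> (\<forall>v. v \<bullet> (M *v v) \<ge> 0)"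

definition pd :: "real^'n^'n \<Rightarrow> bool" where
  "pd M \<longleftrightarrow> transpose M = M \<and> (\<forall>v. v \<noteq> 0 \<longrightarrow> v \<bullet> (M *v v) > 0)"

definition loewner_le :: "real^'n^'n \<Rightarrow> real^'n^'n \<Rightarrow> bool"  (infix \<open>\<preceq>\<^sub>L\<close> 50) where
  "M \<preceq>\<^sub>L N \<longleftrightarrow> psd (N - M)"

definition diagonal_matrix :: "real^'n^'n \<Rightarrow> bool" where
  "diagonal_matrix M \<longleftrightarrow> (\<forall>i j. i \<noteq> j \<longrightarrow> M $ i $ j = 0)"

text \<open>Only used for symmetric matrices, whose set of real eigenvalues is finite and nonempty.\<close>

definition eigenvalues :: "real^'n^'n \<Rightarrow> real set" where
  "eigenvalues M = {l. \<exists>v. v \<noteq> 0 \<and> M *v v = l *\<^sub>R v}"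

definition lambda_max :: "real^'n^'n \<Rightarrow> real" where
  "lambda_max M = Max (eigenvalues M)"

definition lambda_min :: "real^'n^'n \<Rightarrow> real" where
  "lambda_min M = Min (eigenvalues M)"

definition block_mat ::
  "real^'c^'a \<Rightarrow> real^'d^'a \<Rightarrow> real^'c^'b \<Rightarrow> real^'d^'b \<Rightarrow> real^('c + 'd)^('a + 'b)" where
  "block_mat M11 M12 M21 M22 = (\<chi> i j. case i of
       Inl a \<Rightarrow> (case j of Inl c \<Rightarrow> M11 $ a $ c | Inr d \<Rightarrow> M12 $ a $ d)
     | Inr b \<Rightarrow> (case j of Inl c \<Rightarrow> M21 $ b $ c | Inr d \<Rightarrow> M22 $ b $ d))"

definition vstack :: "real^'c^'a \<Rightarrow> real^'c^'b \<Rightarrow> real^'c^('a + 'b)" where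
  "vstack M N = (\<chi> i j. case i of Inl a \<Rightarrow> M $ a $ j | Inr b \<Rightarrow> N $ b $ j)"

text \<open>
  Column vectors \<open>v\<^sub>1, v\<^sub>2, \<dots>\<close> of different lengths, one for every \<open>j :: 'j\<close>, are represented by
  the stacked vector \<open>v :: real^'p\<close> together with a map \<open>blk :: 'p \<Rightarrow> 'j\<close> telling to which
  block an entry belongs: the entries of \<open>v\<^sub>j\<close> are the \<open>v $ p\<close> with \<open>blk p = j\<close>, so the length
  of \<open>v\<^sub>j\<close> is \<open>card {p. blk p = j}\<close>. With this indexing \<open>blkdiag blk v\<close> is
  \<open>blkdiag(v\<^sub>1, v\<^sub>2, \<dots>)\<close>. Likewise a matrix \<open>E = [E\<^sub>1 E\<^sub>2 \<dots>]\<close> has as the columns of its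
  block \<open>E\<^sub>j\<close> the columns \<open>p\<close> of \<open>E\<close> with \<open>blk p = j\<close>, and \<open>block_mult blk E v j\<close> is the
  product \<open>E\<^sub>j v\<^sub>j\<close>.
\<close>

definition blkdiag :: "('p \<Rightarrow> 'j) \<Rightarrow> real^'p \<Rightarrow> real^'j^'p" where
  "blkdiag blk v = (\<chi> p j. if blk p = j then v $ p else 0)"

definition block_mult :: "('p \<Rightarrow> 'j) \<Rightarrow> real^'p^'n \<Rightarrow> real^'p \<Rightarrow> 'j \<Rightarrow> real^'n" where
  "block_mult blk E v j = (\<Sum>p | blk p = j. v $ p *\<^sub>R column p E)"

text \<open>
  The matrix \<open>[f(0) \<dots> f(T-1)]\<close>, where \<open>tm :: 't \<Rightarrow> nat\<close> is a bijection from the column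
  indices onto \<open>{..<T}\<close>.
\<close>

definition data_matrix :: "('t \<Rightarrow> nat) \<Rightarrow> (nat \<Rightarrow> real^'n) \<Rightarrow> real^'t^'n" where
  "data_matrix tm f = (\<chi> i t. f (tm t) $ i)"

definition sat :: "real^'m \<Rightarrow> real^'m \<Rightarrow> real^'m" where
  "sat ubar u = (\<chi> i. sgn (u $ i) * min \<bar>u $ i\<bar> (ubar $ i))"

definition ellipsoid :: "real^'n^'n \<Rightarrow> real \<Rightarrow> (real^'n) set" where
  "ellipsoid M \<tau> = {x. x \<bullet> (M *v x) \<le> \<tau>}"

text \<open>
  For \<open>\<xi>\<close> continuous on the compact ball, supremum and infimum are maximum and minimum.
\<close>

definition max_min_vectors :: "(real^'n \<Rightarrow> real^'p) \<Rightarrow> real \<Rightarrow> (real^'p) set" where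
  "max_min_vectors \<xi> r =
     {\<zeta>. \<forall>p. \<zeta> $ p \<in> {(SUP x\<in>cball 0 r. \<xi> x $ p), (INF x\<in>cball 0 r. \<xi> x $ p)}}"

definition vertex_set ::
  "('p::finite \<Rightarrow> 'n::finite) \<Rightarrow> (real^'n \<Rightarrow> real^'p)
     \<Rightarrow> ('q::finite \<Rightarrow> 'm::finite) \<Rightarrow> (real^'n \<Rightarrow> real^'q) \<Rightarrow> real
     \<Rightarrow> (real^('n + 'm)^('p + 'q)) set" where
  "vertex_set blkA \<xi>A blkB \<xi>B r =
     {block_mat (blkdiag blkA \<zeta>A) 0 0 (blkdiag blkB \<zeta>B) | \<zeta>A \<zeta>B.
        \<zeta>A \<in> max_min_vectors \<xi>A r \<and> \<zeta>B \<in> max_min_vectors \<xi>B r}"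

text \<open>The quotient under the root is read as \<open>+\<infinity>\<close> if its denominator vanishes.\<close>

definition roa_radius :: "real^'n^'n \<Rightarrow> real \<Rightarrow> real \<Rightarrow> real" where
  "roa_radius \<Gamma> \<epsilon> r =
     (let D = (lambda_max \<Gamma>)\<^sup>2 - \<epsilon> * lambda_min \<Gamma>
      in if D = 0 then r
         else min r (sqrt (lambda_max \<Gamma> * lambda_min \<Gamma> / D) * r))"

text \<open>
  A system \<open>x\<^sup>+ = f(x)\<close> is only meaningful on \<open>X\<close>, while \<open>f\<close> is total; hence both notions below
  require the solution \<open>k \<mapsto> (f ^^ k) x0\<close> to stay in \<open>X\<close>.
\<close>

definition region_of_attraction ::
  "(real^'n) set \<Rightarrow> (real^'n \<Rightarrow> real^'n) \<Rightarrow> (real^'n) set \<Rightarrow> bool" where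
  "region_of_attraction X f R \<longleftrightarrow> f 0 = 0 \<and>
     (\<forall>x0\<in>R. (\<forall>k. (f ^^ k) x0 \<in> X) \<and> (\<lambda>k. (f ^^ k) x0) \<longlonglongrightarrow> 0)"

definition exp_convergent_from ::
  "(real^'n) set \<Rightarrow> (real^'n \<Rightarrow> real^'n) \<Rightarrow> (real^'n) set \<Rightarrow> bool" where
  "exp_convergent_from X f R \<longleftrightarrow>
     (\<exists>c \<rho>. c > 0 \<and> 0 < \<rho> \<and> \<rho> < 1 \<and>
        (\<forall>x0\<in>R. \<forall>k. (f ^^ k) x0 \<in> X \<and> norm ((f ^^ k) x0) \<le> c * \<rho> ^ k * norm x0))"

end

theory Submission
  imports Defs
begin

text \<open>
  With \<open>P = \<Gamma>\<^sup>-\<^sup>1\<close> and \<open>v = P x\<close>, test the matrix inequality on the vector consisting of \<open>v\<close>,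
  \<open>w = S\<^sup>-\<^sup>1 (sat (K x) - K x)\<close>, \<open>p = P x\<^sup>+\<close> and \<open>q = [E\<^sub>A E\<^sub>B]\<^sup>T p\<close>. The terms in \<open>\<A>, \<B>, \<C>\<close> then have
  a sign because the true coefficients are consistent with the data, and the terms in \<open>w\<close> have a
  sign by the sector condition for the saturation, valid on the ellipsoid. The remaining term is
  linear in the entries of \<open>Q\<close>, so the current value of the basis functions is dominated by some
  vertex. This yields \<open>V(x\<^sup>+) \<le> V(x) - \<epsilon> |P x|\<^sup>2\<close> for \<open>V(x) = x\<^sup>T P x\<close> as long as \<open>x\<close> lies in the ball of
  radius \<open>r\<close> and in the ellipsoid; the smaller initial ball keeps the solution there.
\<close>

section \<open>Quadratic forms and extreme eigenvalues\<close>

lemma inner_matrix_vector: "x \<bullet> ((M :: real^'n^'m) *v y) = (transpose M *v x) \<bullet> y"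
  by (simp add: dot_lmul_matrix)

lemma inner_symmetric_matrix_vector:
  fixes M :: "real^'n^'n"
  assumes "transpose M = M"
  shows "u \<bullet> (M *v v) = v \<bullet> (M *v u)"
  by (metis assms inner_commute inner_matrix_vector)

text \<open>Source of both the Cauchy-Schwarz inequality for semidefinite matrices and the row bound
  drawn from the saturation inequality. In the former the leading coefficient may vanish, hence the
  case \<open>a = 0\<close>.\<close>

lemma discriminant_of_nonneg:
  fixes a b c :: real
  assumes "\<And>t. 0 \<le> c + 2 * t * b + t\<^sup>2 * a"
  shows "b\<^sup>2 \<le> a * c"
proof -
  have c: "c \<ge> 0" using assms[of 0] by simp
  have a: "a \<ge> 0"
  proof (rule ccontr)
    assume "\<not> a \<ge> 0"
    \<comment> \<open>If \<open>a\<close> were negative, this \<open>t\<close> would be large enough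
      for t^2 |a| to exceed c + 2 t |b|; the final \<open>+ 1\<close> gives
      \<open>t \<ge> 1\<close>, so that t (c + 1) dominates c + 1.\<close>
    define t where "t = (2 * \<bar>b\<bar> + c + 1) / - a + 1"
    have "t \<ge> 1" unfolding t_def using \<open>\<not> a \<ge> 0\<close> c by (simp add: divide_nonneg_neg divide_nonneg_nonpos)
    have "t * - a \<ge> 2 * \<bar>b\<bar> + c + 1"
      unfolding t_def using \<open>\<not> a \<ge> 0\<close> by (simp add: field_simps)
    then have "t * (t * - a) \<ge> t * (2 * \<bar>b\<bar> + c + 1)"
      using \<open>t \<ge> 1\<close> by (intro mult_left_mono) auto
    moreover have "t * (c + 1) \<ge> 1 * (c + 1)" using \<open>t \<ge> 1\<close> c by (intro mult_right_mono) auto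
    moreover have "t * b \<le> t * \<bar>b\<bar>" using \<open>t \<ge> 1\<close> by (intro mult_left_mono) auto
    ultimately show False using assms[of t] by (simp add: power2_eq_square algebra_simps)
  qed
  show ?thesis
  proof (cases "a = 0")
    case True
    have "b = 0"
    proof (rule ccontr)
      assume "b \<noteq> 0"
      \<comment> \<open>At this point the affine function c + 2 t b takes the value -1.\<close>
      then show False using assms[of "- (c + 1) / (2 * b)"] True by (simp add: field_simps)
    qed
    then show ?thesis using True by simp
  next
    case False
    then have "a > 0" using a by simp
    then have "c + 2 * (- b / a) * b + (- b / a)\<^sup>2 * a = c - b\<^sup>2 / a"
      by (simp add: field_simps power2_eq_square)
    then have "b\<^sup>2 / a \<le> c" using assms[of "- b / a"] by linarith
    then show ?thesis using \<open>a > 0\<close> by (simp add: field_simps)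
  qed
qed

lemma quadratic_form_add_scaleR:
  fixes M :: "real^'n^'n"
  assumes "transpose M = M"
  shows "(u + t *\<^sub>R v) \<bullet> (M *v (u + t *\<^sub>R v))
       = u \<bullet> (M *v u) + 2 * t * (u \<bullet> (M *v v)) + t\<^sup>2 * (v \<bullet> (M *v v))"
  using inner_symmetric_matrix_vector[OF assms, of u v]
  by (simp add: matrix_vector_right_distrib matrix_vector_mult_scaleR
      inner_add_left inner_add_right power2_eq_square algebra_simps)

lemma psd_cauchy_schwarz:
  fixes M :: "real^'n^'n"
  assumes "psd M"
  shows "(u \<bullet> (M *v v))\<^sup>2 \<le> (v \<bullet> (M *v v)) * (u \<bullet> (M *v u))"
proof (rule discriminant_of_nonneg)
  fix t :: real
  show "0 \<le> u \<bullet> (M *v u) + 2 * t * (u \<bullet> (M *v v)) + t\<^sup>2 * (v \<bullet> (M *v v))"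
    using assms unfolding psd_def by (metis quadratic_form_add_scaleR)
qed

text \<open>Eigenvectors for distinct eigenvalues are orthogonal, and a pairwise orthogonal set in
  finite dimension is finite. Without finiteness, \<open>Max\<close> and \<open>Min\<close> in
  \<open>lambda_max\<close> and \<open>lambda_min\<close> would carry no information.\<close>

lemma finite_eigenvalues:
  fixes M :: "real^'n^'n"
  assumes sym: "transpose M = M"
  shows "finite (eigenvalues M)"
proof -
  define w where "w l = (SOME v. v \<noteq> 0 \<and> M *v v = l *\<^sub>R v)" for l
  have w: "w l \<noteq> 0 \<and> M *v w l = l *\<^sub>R w l" if "l \<in> eigenvalues M" for l
    unfolding w_def by (rule someI_ex) (use that in \<open>auto simp: eigenvalues_def\<close>)
  have orth: "w l \<bullet> w l' = 0" if "l \<in> eigenvalues M" "l' \<in> eigenvalues M" "l \<noteq> l'" for l l'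
  proof -
    have "w l \<bullet> (M *v w l') = w l' \<bullet> (M *v w l)" by (rule inner_symmetric_matrix_vector[OF sym])
    then have "l' * (w l \<bullet> w l') = l * (w l' \<bullet> w l)"
      using w[OF that(1)] w[OF that(2)] by simp
    then have "(l' - l) * (w l \<bullet> w l') = 0" by (simp add: inner_commute[of "w l'"] algebra_simps)
    then show ?thesis using that(3) by simp
  qed
  have inj: "inj_on w (eigenvalues M)"
  proof (rule inj_onI, rule ccontr)
    fix l l' assume *: "l \<in> eigenvalues M" "l' \<in> eigenvalues M" "w l = w l'" "l \<noteq> l'"
    then show False using orth[OF *(1,2,4)] w[OF *(2)] by simp
  qed
  have "pairwise orthogonal (w ` eigenvalues M)"
    unfolding pairwise_def orthogonal_def using orth by fastforce
  then have "finite (w ` eigenvalues M)" by (rule pairwise_orthogonal_imp_finite)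
  then show ?thesis using inj by (simp add: finite_image_iff)
qed

text \<open>A minimiser of the quadratic form on the unit sphere is an eigenvector.\<close>

lemma minimal_eigenvalue_exists:
  fixes M :: "real^'n^'n"
  assumes sym: "transpose M = M"
  obtains l where "l \<in> eigenvalues M" "\<And>v. l * (v \<bullet> v) \<le> v \<bullet> (M *v v)"
proof -
  have ne: "sphere (0 :: real^'n) 1 \<noteq> {}" by simp
  have "continuous_on (sphere (0 :: real^'n) 1) (\<lambda>v. v \<bullet> (M *v v))"
    by (intro continuous_intros)
  then obtain u where u: "u \<in> sphere 0 1"
    and min: "\<And>v. v \<in> sphere 0 1 \<Longrightarrow> u \<bullet> (M *v u) \<le> v \<bullet> (M *v v)"
    using continuous_attains_inf[OF compact_sphere ne] by blast
  define l where "l = u \<bullet> (M *v u)"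
  have bound: "l * (v \<bullet> v) \<le> v \<bullet> (M *v v)" for v
  proof (cases "v = 0")
    case False
    have "l \<le> sgn v \<bullet> (M *v sgn v)"
      unfolding l_def using False by (intro min) (simp add: norm_sgn)
    also have "\<dots> = (v \<bullet> (M *v v)) / (v \<bullet> v)"
      by (simp add: sgn_div_norm matrix_vector_mult_scaleR dot_square_norm power2_eq_square field_simps)
    finally show ?thesis using False by (simp add: field_simps)
  qed simp
  \<comment> \<open>\<open>N\<close> is semidefinite and its form vanishes at \<open>u\<close>.
    Cauchy-Schwarz for this form, with test vector \<open>N *v u\<close>, forces
    \<open>N *v u = 0\<close>; this replaces a Lagrange multiplier argument.\<close>
  define N where "N = M - l *\<^sub>R mat 1"
  have Nv: "N *v v = M *v v - l *\<^sub>R v" for v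
    by (simp add: N_def matrix_vector_mult_diff_rdistrib flip: scaleR_matrix_vector_assoc)
  have "transpose N = N" using sym by (auto simp: N_def transpose_def vec_eq_iff mat_def)
  then have "psd N" unfolding psd_def using bound by (simp add: Nv inner_diff_right)
  have "u \<bullet> u = 1" using u by (simp add: dot_square_norm)
  then have "u \<bullet> (N *v u) = 0" by (simp add: Nv inner_diff_right l_def)
  with psd_cauchy_schwarz[OF \<open>psd N\<close>, of "N *v u" u] have "N *v u = 0" by simp
  then have "M *v u = l *\<^sub>R u" by (simp add: Nv)
  moreover have "u \<noteq> 0" using u by auto
  ultimately have "l \<in> eigenvalues M" unfolding eigenvalues_def by blast
  then show thesis using bound that by blast
qed

lemma lambda_min_bound:
  fixes M :: "real^'n^'n"
  assumes sym: "transpose M = M"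
  shows "lambda_min M \<in> eigenvalues M" "lambda_min M * (v \<bullet> v) \<le> v \<bullet> (M *v v)"
proof -
  obtain l where l: "l \<in> eigenvalues M" "\<And>v. l * (v \<bullet> v) \<le> v \<bullet> (M *v v)"
    using minimal_eigenvalue_exists[OF sym] by blast
  show "lambda_min M \<in> eigenvalues M"
    unfolding lambda_min_def using l(1) finite_eigenvalues[OF sym] by (intro Min_in) auto
  have "lambda_min M \<le> l"
    unfolding lambda_min_def using l(1) finite_eigenvalues[OF sym] by (intro Min_le) auto
  then have "lambda_min M * (v \<bullet> v) \<le> l * (v \<bullet> v)" by (intro mult_right_mono) auto
  then show "lambda_min M * (v \<bullet> v) \<le> v \<bullet> (M *v v)" using l(2)[of v] by linarith
qed

lemma lambda_max_bound:
  fixes M :: "real^'n^'n"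
  assumes sym: "transpose M = M"
  shows "v \<bullet> (M *v v) \<le> lambda_max M * (v \<bullet> v)"
proof -
  have symN: "transpose (- M) = - M" using sym by (simp add: transpose_def vec_eq_iff)
  have minus: "(- M) *v w = - (M *v w)" for w
    using matrix_vector_mult_diff_rdistrib[of 0 M w] by simp
  \<comment> \<open>A maximum for \<open>M\<close> is a minimum for \<open>- M\<close>, and the
    eigenvalues change sign.\<close>
  obtain l where l: "l \<in> eigenvalues (- M)" "\<And>v. l * (v \<bullet> v) \<le> v \<bullet> ((- M) *v v)"
    using minimal_eigenvalue_exists[OF symN] by blast
  have "- l \<in> eigenvalues M"
    using l(1) unfolding eigenvalues_def minus
    by auto (metis add.inverse_inverse)
  then have "- l \<le> lambda_max M"
    unfolding lambda_max_def using finite_eigenvalues[OF sym] by (intro Max_ge) auto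
  then have "- l * (v \<bullet> v) \<le> lambda_max M * (v \<bullet> v)" by (intro mult_right_mono) auto
  then show ?thesis using l(2)[of v] by (simp add: minus)
qed

lemma pd_imp_psd: "pd M \<Longrightarrow> psd M"
  unfolding pd_def psd_def by (metis inner_zero_left order.refl order.strict_implies_order)

lemma lambda_min_pos:
  assumes "pd M"
  shows "lambda_min M > 0"
proof -
  have sym: "transpose M = M" using assms by (simp add: pd_def)
  obtain v where v: "v \<noteq> 0" "M *v v = lambda_min M *\<^sub>R v"
    using lambda_min_bound(1)[OF sym] unfolding eigenvalues_def by blast
  have "0 < v \<bullet> (M *v v)" using assms v(1) unfolding pd_def by blast
  also have "\<dots> = lambda_min M * (v \<bullet> v)" by (simp add: v(2))
  finally show ?thesis using inner_ge_zero[of v] by (auto simp: zero_less_mult_iff)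
qed

lemma lambda_min_le_lambda_max:
  assumes "transpose M = M"
  shows "lambda_min M \<le> lambda_max M"
  unfolding lambda_max_def
  using lambda_min_bound(1)[OF assms] finite_eigenvalues[OF assms] by (intro Max_ge) auto

text \<open>With x = M y this reads |x|^2 <= lambda_max(M) x^T M^-1 x, so the spectrum of the
  inverse need not be studied. It comes from Cauchy-Schwarz for the form of \<open>M\<close> at
  \<open>M *v y\<close> and \<open>y\<close>, after dividing by |M y|^2.\<close>

lemma pd_image_norm_bound:
  assumes "pd M"
  shows "(M *v y) \<bullet> (M *v y) \<le> lambda_max M * (y \<bullet> (M *v y))"
proof (cases "M *v y = 0")
  case False
  have sym: "transpose M = M" and psd: "psd M"
    using assms pd_imp_psd by (auto simp: pd_def)
  let ?z = "M *v y"
  have z: "?z \<bullet> ?z > 0" using False by simp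
  have "y \<bullet> ?z \<ge> 0" using psd unfolding psd_def by blast
  have "(?z \<bullet> ?z)\<^sup>2 \<le> (y \<bullet> ?z) * (?z \<bullet> (M *v ?z))"
    using psd_cauchy_schwarz[OF psd, of ?z y] .
  also have "\<dots> \<le> (y \<bullet> ?z) * (lambda_max M * (?z \<bullet> ?z))"
    using lambda_max_bound[OF sym, of ?z] \<open>y \<bullet> ?z \<ge> 0\<close> by (intro mult_left_mono)
  finally have "(?z \<bullet> ?z) * (?z \<bullet> ?z) \<le> (lambda_max M * (y \<bullet> ?z)) * (?z \<bullet> ?z)"
    by (simp add: power2_eq_square algebra_simps)
  then show ?thesis using z by (simp only: mult_le_cancel_right_pos)
qed simp

lemma pd_inverse:
  fixes M :: "real^'n^'n"
  assumes "pd M"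
  shows "M ** matrix_inv M = mat 1"
proof -
  have "M *v v = 0 \<Longrightarrow> v = 0" for v
    using assms unfolding pd_def by (metis inner_zero_right less_irrefl)
  then obtain N where "N ** M = mat 1" using matrix_left_invertible_ker by blast
  then have "\<exists>N. M ** N = mat 1 \<and> N ** M = mat 1" using matrix_left_right_inverse by blast
  then show ?thesis unfolding matrix_inv_def by (rule someI2_ex) blast
qed

section \<open>Quadratic forms of block matrices\<close>

definition vjoin :: "real^'a \<Rightarrow> real^'b \<Rightarrow> real^('a + 'b)" where
  "vjoin u v = (\<chi> i. case i of Inl a \<Rightarrow> u $ a | Inr b \<Rightarrow> v $ b)"

lemma sum_UNIV_Plus:
  "(\<Sum>i\<in>(UNIV :: ('a::finite + 'b::finite) set). f i) = (\<Sum>a\<in>UNIV. f (Inl a)) + (\<Sum>b\<in>UNIV. f (Inr b))"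
  by (simp add: UNIV_Plus_UNIV[symmetric] sum.Plus del: UNIV_Plus_UNIV)

lemma vjoin_eqI:
  assumes "\<And>a. z $ Inl a = u $ a" "\<And>b. z $ Inr b = v $ b"
  shows "z = vjoin u v"
  unfolding vec_eq_iff by (intro allI) (simp add: vjoin_def assms split: sum.split)

lemma inner_vjoin: "vjoin u v \<bullet> vjoin u' v' = u \<bullet> u' + v \<bullet> v'"
  by (simp add: inner_vec_def sum_UNIV_Plus vjoin_def)

lemma vjoin_add: "vjoin u v + vjoin u' v' = vjoin (u + u') (v + v')"
  by (rule vjoin_eqI) (simp_all add: vjoin_def)

lemma block_mat_vjoin:
  "block_mat M11 M12 M21 M22 *v vjoin u v = vjoin (M11 *v u + M12 *v v) (M21 *v u + M22 *v v)"
  by (rule vjoin_eqI)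
    (simp_all add: matrix_vector_mult_def block_mat_def vjoin_def sum_UNIV_Plus)

lemma vstack_mult: "vstack M N *v x = vjoin (M *v x) (N *v x)"
  by (rule vjoin_eqI) (simp_all add: matrix_vector_mult_def vstack_def)

lemma transpose_vstack_mult:
  "transpose (vstack M N) *v vjoin u v = transpose M *v u + transpose N *v v"
  by (simp add: vec_eq_iff matrix_vector_mult_def transpose_def vstack_def vjoin_def sum_UNIV_Plus)

lemma inner_transpose: "x \<bullet> (transpose (M :: real^'n^'m) *v y) = y \<bullet> (M *v x)"
  by (metis inner_commute inner_matrix_vector transpose_transpose)

lemma matrix_vector_mult_minus_left: "(- M) *v w = - ((M :: real^'n^'m) *v w)"
  using matrix_vector_mult_diff_rdistrib[of 0 M w] by simp

lemma matrix_vector_mult_scaleR_left: "(k *\<^sub>R M) *v w = k *\<^sub>R ((M :: real^'n^'m) *v w)"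
  by (simp add: scaleR_matrix_vector_assoc)

text \<open>The matrix inequality tested on the stacked vector (v, w, p, q). The terms in
  \<open>\<A>\<close>, \<open>\<B>\<close>, \<open>\<C>\<close> are collected on the right, where
  \<open>consistent_data_quadratic_form\<close> later bounds them by 0.\<close>

lemma data_lmi_quadratic_form:
  fixes \<Gamma> \<C> :: "real^'n^'n" and Y W :: "real^'n^'m" and S :: "real^'m^'m"
    and \<A> :: "real^('p::finite + 'q::finite)^('p + 'q)" and \<B> :: "real^('p + 'q)^'n"
    and Q :: "real^('n + 'm)^('p + 'q)"
  assumes "block_mat
         (block_mat (- \<Gamma> + \<epsilon> *\<^sub>R mat 1) (- transpose Y - transpose W)
                    (- Y - W)               (- (2 *\<^sub>R S)))
         (block_mat (0 :: real^'n^'n) (transpose (vstack \<Gamma> Y) ** transpose Q)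
                    0                 (transpose (vstack 0 S) ** transpose Q))
         (block_mat 0                  0
                    (Q ** vstack \<Gamma> Y) (Q ** vstack 0 S))
         (block_mat (- \<Gamma> - \<C>)      (- \<B>)
                    (- transpose \<B>) (- \<A>))
       \<preceq>\<^sub>L 0" (is "?M \<preceq>\<^sub>L 0")
  shows "\<epsilon> * (v \<bullet> v) - v \<bullet> (\<Gamma> *v v) - 2 * (w \<bullet> (Y *v v + W *v v + S *v w)) - p \<bullet> (\<Gamma> *v p)
       + 2 * (q \<bullet> (Q *v vjoin (\<Gamma> *v v) (Y *v v + S *v w)))
       \<le> p \<bullet> (\<C> *v p) + 2 * (p \<bullet> (\<B> *v q)) + q \<bullet> (\<A> *v q)"
proof -
  let ?z = "vjoin (vjoin v w) (vjoin p q)"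
  have "0 \<le> ?z \<bullet> ((0 - ?M) *v ?z)"
    using assms unfolding loewner_le_def psd_def by blast
  then have "?z \<bullet> (?M *v ?z) \<le> 0"
    by (simp add: matrix_vector_mult_minus_left)
  then have "v \<bullet> (- (\<Gamma> *v v) + \<epsilon> *\<^sub>R v - transpose Y *v w - transpose W *v w)
      + w \<bullet> (- (Y *v v) - W *v v - 2 *\<^sub>R (S *v w))
      + v \<bullet> (transpose (vstack \<Gamma> Y) *v (transpose Q *v q))
      + w \<bullet> (transpose (vstack 0 S) *v (transpose Q *v q))
      + q \<bullet> (Q *v (vstack \<Gamma> Y *v v)) + q \<bullet> (Q *v (vstack 0 S *v w))
      + p \<bullet> (- (\<Gamma> *v p) - \<C> *v p - \<B> *v q) + q \<bullet> (- (transpose \<B> *v p) - \<A> *v q) \<le> 0"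
    unfolding block_mat_vjoin vjoin_add inner_vjoin
    by (simp add: matrix_vector_mult_minus_left matrix_vector_mult_diff_rdistrib
        matrix_vector_mult_add_rdistrib matrix_vector_mult_scaleR_left inner_add_right
        inner_diff_right add_ac del: transpose_matrix_vector flip: matrix_vector_mul_assoc)
  moreover have "vjoin (\<Gamma> *v v) (Y *v v + S *v w) = vstack \<Gamma> Y *v v + vstack 0 S *v w"
    by (simp add: vstack_mult vjoin_add)
  moreover have "(vstack \<Gamma> Y *v v) \<bullet> (transpose Q *v q) = q \<bullet> (Q *v (vstack \<Gamma> Y *v v))"
    "(vstack 0 S *v w) \<bullet> (transpose Q *v q) = q \<bullet> (Q *v (vstack 0 S *v w))"
    by (simp_all only: inner_transpose)
  moreover have "v \<bullet> (transpose (vstack \<Gamma> Y) *v (transpose Q *v q)) = q \<bullet> (Q *v (vstack \<Gamma> Y *v v))"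
    "w \<bullet> (transpose (vstack 0 S) *v (transpose Q *v q)) = q \<bullet> (Q *v (vstack 0 S *v w))"
    by (metis inner_commute inner_transpose)+
  ultimately show ?thesis
    by (simp add: inner_add_right inner_diff_right inner_transpose matrix_vector_right_distrib algebra_simps
        del: transpose_matrix_vector)
qed

text \<open>A Schur complement without an inverse: on test vectors (v, t) the form is a quadratic
  polynomial in \<open>t\<close>, and its discriminant is the claim.\<close>

lemma row_lmi_bound:
  fixes \<Gamma> :: "real^'n^'n" and c :: real
  assumes "psd (block_mat \<Gamma> (columnvector w :: real^1^'n) (rowvector w) (mat c))"
  shows "(w \<bullet> v)\<^sup>2 \<le> c * (v \<bullet> (\<Gamma> *v v))"
proof (rule discriminant_of_nonneg)
  fix t :: real
  let ?z = "vjoin v (vec t :: real^1)"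
  have col: "(columnvector w :: real^1^'n) *v vec t = t *\<^sub>R w"
    by (simp add: vec_eq_iff matrix_vector_mult_def columnvector_def)
  have row: "(rowvector w :: real^'n^1) *v v = vec (w \<bullet> v)"
    by (simp add: vec_eq_iff matrix_vector_mult_def rowvector_def inner_vec_def)
  have mat: "(mat c :: real^1^1) *v vec t = vec (c * t)"
    by (simp add: vec_eq_iff matrix_vector_mult_def mat_def)
  have "0 \<le> ?z \<bullet> (block_mat \<Gamma> (columnvector w :: real^1^'n) (rowvector w) (mat c) *v ?z)"
    using assms unfolding psd_def by blast
  also have "\<dots> = v \<bullet> (\<Gamma> *v v) + 2 * t * (w \<bullet> v) + t\<^sup>2 * c"
    unfolding block_mat_vjoin inner_vjoin col row mat
    by (simp add: inner_add_right inner_commute[of v w] inner_vec_def[where 'b=1] power2_eq_square algebra_simps)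
  finally show "0 \<le> v \<bullet> (\<Gamma> *v v) + 2 * t * (w \<bullet> v) + t\<^sup>2 * c" .
qed

section \<open>Data-consistent systems and vertex matrices\<close>

lemma matrix_mult_data_matrix: "M ** data_matrix tm f = data_matrix tm (\<lambda>k. M *v f k)"
  by (simp add: vec_eq_iff matrix_matrix_mult_def matrix_vector_mult_def data_matrix_def)

lemma data_matrix_add: "data_matrix tm f + data_matrix tm g = data_matrix tm (\<lambda>k. f k + g k)"
  by (simp add: vec_eq_iff data_matrix_def)

lemma inner_gram: "p \<bullet> ((M ** transpose M) *v p) = (transpose M *v p) \<bullet> (transpose (M :: real^'n^'m) *v p)"
  by (simp add: inner_matrix_vector flip: matrix_vector_mul_assoc)

text \<open>The left side is |X1^T p - Z^T q|^2 - p^T Theta p. For \<open>q\<close> built from the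
  true coefficients the difference inside the norm is exactly D0^T p, so the noise bound settles the
  sign.\<close>

lemma consistent_data_quadratic_form:
  fixes X0 :: "real^'t^'p" and U0 :: "real^'t^'q" and X1 D0 :: "real^'t^'n"
  assumes X1: "X1 = EA ** X0 + EB ** U0 + D0"
    and noise: "D0 ** transpose D0 \<preceq>\<^sub>L \<Theta>"
    and q: "q = vjoin (transpose EA *v p) (transpose EB *v p)"
  defines "Z \<equiv> vstack X0 U0"
  shows "p \<bullet> ((X1 ** transpose X1 - \<Theta>) *v p) + 2 * (p \<bullet> ((- (X1 ** transpose Z)) *v q))
       + q \<bullet> ((Z ** transpose Z) *v q) \<le> 0"
proof -
  define a b g where "a = transpose X1 *v p" and "b = transpose Z *v q" and "g = transpose D0 *v p"
  have tadd: "transpose (M + N) = transpose M + transpose N" for M N :: "real^'t^'n"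
    by (simp add: transpose_def vec_eq_iff)
  have "a = b + g"
    unfolding a_def b_def g_def Z_def q transpose_vstack_mult X1
    by (simp add: tadd matrix_transpose_mul matrix_vector_mult_add_rdistrib matrix_vector_mul_assoc
        del: transpose_matrix_vector)
  have "p \<bullet> ((D0 ** transpose D0) *v p) \<le> p \<bullet> (\<Theta> *v p)"
    using noise unfolding loewner_le_def psd_def
    by (simp add: matrix_vector_mult_diff_rdistrib inner_diff_right)
  then have g: "g \<bullet> g \<le> p \<bullet> (\<Theta> *v p)" by (simp add: inner_gram g_def)
  have cross: "p \<bullet> ((X1 ** transpose Z) *v q) = a \<bullet> b"
    by (simp add: a_def b_def inner_matrix_vector flip: matrix_vector_mul_assoc)
  have "p \<bullet> ((X1 ** transpose X1 - \<Theta>) *v p) + 2 * (p \<bullet> ((- (X1 ** transpose Z)) *v q))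
       + q \<bullet> ((Z ** transpose Z) *v q) = a \<bullet> a - p \<bullet> (\<Theta> *v p) - 2 * (a \<bullet> b) + b \<bullet> b"
    using cross by (simp add: matrix_vector_mult_diff_rdistrib matrix_vector_mult_minus_left
        inner_diff_right inner_gram del: transpose_matrix_vector flip: a_def b_def)
  also have "\<dots> = g \<bullet> g - p \<bullet> (\<Theta> *v p)"
    by (simp add: \<open>a = b + g\<close> inner_add_left inner_add_right inner_commute[of g b])
  finally show ?thesis using g by simp
qed

lemma eq_matrix_mult_blkdiag:
  assumes "\<And>j. column j M = block_mult blk E v j"
  shows "M = E ** blkdiag blk v"
proof -
  have "M $ i $ j = (E ** blkdiag blk v) $ i $ j" for i j
  proof -
    have "M $ i $ j = column j M $ i" by (simp add: column_def)
    also have "\<dots> = (\<Sum>p | blk p = j. v $ p * E $ i $ p)"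
      unfolding assms block_mult_def by (simp add: column_def)
    also have "\<dots> = (\<Sum>p\<in>UNIV. if blk p = j then v $ p * E $ i $ p else 0)"
      using sum.inter_filter[of UNIV "\<lambda>p. v $ p * E $ i $ p" "\<lambda>p. blk p = j"] by simp
    also have "\<dots> = (E ** blkdiag blk v) $ i $ j"
      unfolding matrix_matrix_mult_def blkdiag_def by (simp, intro sum.cong) auto
    finally show ?thesis .
  qed
  then show ?thesis by (simp add: vec_eq_iff)
qed

text \<open>Displays the form as linear in the block entries \<open>v\<close>, which is what permits
  passing to extreme values of each entry.\<close>

lemma inner_blkdiag: "q \<bullet> (blkdiag blk v *v a) = (\<chi> p. q $ p * a $ blk p) \<bullet> v"
proof -
  have "(blkdiag blk v *v a) $ p = v $ p * a $ blk p" for p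
    by (simp add: blkdiag_def matrix_vector_mult_def if_distrib[of "\<lambda>c. c * _"] cong: if_cong)
  then show ?thesis by (simp add: inner_vec_def mult_ac)
qed

text \<open>A linear functional on a box is largest at a corner: the sign of each coefficient of
  \<open>c\<close> selects maximum or minimum of that entry. Compactness of the ball makes these
  bounds finite.\<close>

lemma max_min_vectors_dominate:
  fixes \<xi> :: "real^'n \<Rightarrow> real^'p"
  assumes cont: "continuous_on (cball 0 r) \<xi>" and x: "x \<in> cball 0 r"
  obtains \<zeta> where "\<zeta> \<in> max_min_vectors \<xi> r" "c \<bullet> \<xi> x \<le> c \<bullet> \<zeta>"
proof
  define \<zeta> where "\<zeta> = (\<chi> p. if c $ p \<ge> 0 then (SUP x\<in>cball 0 r. \<xi> x $ p) else (INF x\<in>cball 0 r. \<xi> x $ p))"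
  show "\<zeta> \<in> max_min_vectors \<xi> r" by (simp add: max_min_vectors_def \<zeta>_def)
  have "c $ p * \<xi> x $ p \<le> c $ p * \<zeta> $ p" for p
  proof -
    have "compact ((\<lambda>x. \<xi> x $ p) ` cball 0 r)"
      by (intro compact_continuous_image continuous_on_component cont compact_cball)
    then have b: "bounded ((\<lambda>x. \<xi> x $ p) ` cball 0 r)" by (rule compact_imp_bounded)
    have "\<xi> x $ p \<le> (SUP x\<in>cball 0 r. \<xi> x $ p)"
      by (rule cSUP_upper[OF x bounded_imp_bdd_above[OF b]])
    moreover have "(INF x\<in>cball 0 r. \<xi> x $ p) \<le> \<xi> x $ p"
      by (rule cINF_lower[OF bounded_imp_bdd_below[OF b] x])
    ultimately show ?thesis
      by (auto simp: \<zeta>_def intro: mult_left_mono mult_left_mono_neg)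
  qed
  then show "c \<bullet> \<xi> x \<le> c \<bullet> \<zeta>" by (simp add: inner_vec_def sum_mono)
qed

text \<open>The vertex depends on \<open>x\<close> and on all the test vectors. This is harmless,
  since the matrix inequality is assumed at every vertex, and no convex combination of vertices has
  to be formed.\<close>

lemma vertex_set_dominate:
  fixes \<xi>A :: "real^'n \<Rightarrow> real^'p" and \<xi>B :: "real^'n \<Rightarrow> real^'q" and blkB :: "'q \<Rightarrow> 'm::finite"
  assumes "continuous_on (cball 0 r) \<xi>A" "continuous_on (cball 0 r) \<xi>B" "x \<in> cball 0 r"
  obtains Q where "Q \<in> vertex_set blkA \<xi>A blkB \<xi>B r"
    "qA \<bullet> (blkdiag blkA (\<xi>A x) *v a) + qB \<bullet> (blkdiag blkB (\<xi>B x) *v b) \<le> vjoin qA qB \<bullet> (Q *v vjoin a b)"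
proof -
  obtain \<zeta>A where A: "\<zeta>A \<in> max_min_vectors \<xi>A r"
    "(\<chi> p. qA $ p * a $ blkA p) \<bullet> \<xi>A x \<le> (\<chi> p. qA $ p * a $ blkA p) \<bullet> \<zeta>A"
    using max_min_vectors_dominate[OF assms(1,3)] .
  obtain \<zeta>B where B: "\<zeta>B \<in> max_min_vectors \<xi>B r"
    "(\<chi> p. qB $ p * b $ blkB p) \<bullet> \<xi>B x \<le> (\<chi> p. qB $ p * b $ blkB p) \<bullet> \<zeta>B"
    using max_min_vectors_dominate[OF assms(2,3)] .
  let ?Q = "block_mat (blkdiag blkA \<zeta>A) 0 0 (blkdiag blkB \<zeta>B)"
  have "?Q \<in> vertex_set blkA \<xi>A blkB \<xi>B r" using A(1) B(1) by (auto simp: vertex_set_def)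
  moreover have "qA \<bullet> (blkdiag blkA (\<xi>A x) *v a) + qB \<bullet> (blkdiag blkB (\<xi>B x) *v b)
      \<le> vjoin qA qB \<bullet> (?Q *v vjoin a b)"
    using A(2) B(2) by (simp add: block_mat_vjoin inner_vjoin inner_blkdiag)
  ultimately show thesis by (rule that)
qed

section \<open>Saturation and the decrease of the Lyapunov function\<close>

text \<open>Without saturation the first factor vanishes. With saturation the first factor has the
  sign opposite to \<open>k\<close>, while the bound on \<open>h\<close> leaves the second factor
  zero or with the sign of \<open>k\<close>.\<close>

lemma saturation_sector:
  fixes k h u :: real
  assumes "\<bar>h\<bar> \<le> u" "u > 0"
  shows "(sgn k * min \<bar>k\<bar> u - k) * (sgn k * min \<bar>k\<bar> u + h) \<le> 0"
proof (cases "\<bar>k\<bar> \<le> u")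
  case True
  then show ?thesis by (simp add: sgn_mult_abs mult.commute[of "sgn k"] abs_mult_sgn)
next
  case False
  show ?thesis
  proof (cases "k > 0")
    case True
    then show ?thesis using False assms by (auto intro: mult_nonpos_nonneg)
  next
    case neg: False
    then have "k < 0" using False assms(2) by auto
    then show ?thesis using False assms by (auto intro: mult_nonneg_nonpos)
  qed
qed

text \<open>The scalar sector conditions are added with weights 1 / S_ii. Since \<open>S\<close> is
  diagonal with positive diagonal entries, its inverse can be applied entrywise and the weights
  preserve signs.\<close>

lemma saturation_multiplier:
  fixes S :: "real^'m^'m" and k h ubar :: "real^'m"
  assumes S: "diagonal_matrix S" "pd S" and ubar: "\<And>i. ubar $ i > 0"
    and h: "\<And>i. \<bar>h $ i\<bar> \<le> ubar $ i"
  obtains w where "S *v w = sat ubar k - k" "w \<bullet> (k + h + S *v w) \<le> 0"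
proof
  define w where "w = (\<chi> i. (sat ubar k - k) $ i / S $ i $ i)"
  have pos: "S $ i $ i > 0" for i
  proof -
    have "0 < axis i 1 \<bullet> (S *v axis i 1)"
      using S(2) unfolding pd_def by (simp add: axis_eq_0_iff)
    then show ?thesis
      by (simp add: matrix_vector_mul_component inner_axis' inner_axis row_def)
  qed
  have "(S *v w) $ i = (sat ubar k - k) $ i" for i
  proof -
    have "(S *v w) $ i = (\<Sum>j\<in>UNIV. S $ i $ j * w $ j)"
      by (simp add: matrix_vector_mult_def)
    also have "\<dots> = (\<Sum>j\<in>UNIV. if j = i then S $ i $ i * w $ i else 0)"
      using S(1) by (intro sum.cong) (auto simp: diagonal_matrix_def)
    finally show ?thesis using pos[of i] by (simp add: w_def)
  qed
  then show Sw: "S *v w = sat ubar k - k" by (simp add: vec_eq_iff)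
  have "w $ i * (k + h + S *v w) $ i \<le> 0" for i
  proof -
    have "w $ i * (k + h + S *v w) $ i
        = ((sat ubar k $ i - k $ i) * (sat ubar k $ i + h $ i)) / S $ i $ i"
      unfolding Sw by (simp add: w_def)
    moreover have "(sat ubar k $ i - k $ i) * (sat ubar k $ i + h $ i) \<le> 0"
      using saturation_sector[OF h[of i] ubar, of "k $ i"] by (simp add: sat_def)
    ultimately show ?thesis using pos[of i] by (simp add: divide_nonpos_pos)
  qed
  then show "w \<bullet> (k + h + S *v w) \<le> 0"
    unfolding inner_vec_def by (simp add: sum_nonpos)
qed

lemma saturated_lyapunov_decrease:
  fixes \<Gamma> Ax :: "real^'n^'n" and Bx :: "real^'m^'n" and Y W :: "real^'n^'m" and S :: "real^'m^'m"
  assumes S: "diagonal_matrix S" "pd S" and ubar: "\<And>i. ubar $ i > 0"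
    and rows: "\<And>i v. ((W *v v) $ i)\<^sup>2 \<le> (ubar $ i)\<^sup>2 * (v \<bullet> (\<Gamma> *v v))"
    and form: "\<And>v w p. \<epsilon> * (v \<bullet> v) - v \<bullet> (\<Gamma> *v v) - 2 * (w \<bullet> (Y *v v + W *v v + S *v w))
        - p \<bullet> (\<Gamma> *v p) + 2 * (p \<bullet> (Ax *v (\<Gamma> *v v) + Bx *v (Y *v v + S *v w))) \<le> 0"
    and inv: "\<Gamma> ** P = mat 1"
    and x: "x \<in> ellipsoid P 1"
  defines "x' \<equiv> Ax *v x + Bx *v sat ubar ((Y ** P) *v x)"
  shows "x' \<bullet> (P *v x') \<le> x \<bullet> (P *v x) - \<epsilon> * ((P *v x) \<bullet> (P *v x))"
proof -
  have \<Gamma>P: "\<Gamma> *v (P *v z) = z" for z by (simp add: matrix_vector_mul_assoc inv)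
  define v p k where "v = P *v x" and "p = P *v x'" and "k = Y *v v"
  have k: "k = (Y ** P) *v x" by (simp add: k_def v_def matrix_vector_mul_assoc)
  \<comment> \<open>On the ellipsoid \<open>v \<bullet> (\<Gamma> *v v)\<close> equals
    \<open>x \<bullet> (P *v x)\<close>, hence is at most 1; so \<open>W *v v\<close> qualifies as
    the auxiliary vector of the sector condition.\<close>
  have "\<bar>(W *v v) $ i\<bar> \<le> ubar $ i" for i
  proof -
    have "((W *v v) $ i)\<^sup>2 \<le> (ubar $ i)\<^sup>2 * 1"
      using rows[of v i] x
      by (intro order_trans[OF rows mult_left_mono]) (auto simp: v_def \<Gamma>P ellipsoid_def inner_commute)
    then show ?thesis using ubar[of i] by (simp add: abs_le_square_iff[symmetric])
  qed
  then obtain w where w: "S *v w = sat ubar k - k" "w \<bullet> (k + W *v v + S *v w) \<le> 0"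
    using saturation_multiplier[OF S ubar] by blast
  have "Ax *v (\<Gamma> *v v) + Bx *v (Y *v v + S *v w) = x'"
    by (simp add: v_def \<Gamma>P w(1) x'_def k flip: k_def[unfolded v_def])
  \<comment> \<open>Because p = P x', the terms 2 p^T x' - p^T Gamma p reduce to x'^T P x', the new
    value of the Lyapunov function; the \<open>w\<close> term has a favourable sign and is
    dropped.\<close>
  with form[of v w p] w(2)
  have "\<epsilon> * (v \<bullet> v) - v \<bullet> (\<Gamma> *v v) - p \<bullet> (\<Gamma> *v p) + 2 * (p \<bullet> x') \<le> 0"
    unfolding k_def by simp
  then show ?thesis by (simp add: v_def p_def \<Gamma>P inner_commute)
qed

section \<open>Convergence from the intersection of ball and ellipsoid\<close>

text \<open>The substitution x = Gamma y turns V(x) into y^T Gamma y, so every constant is an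
  extreme eigenvalue of \<open>\<Gamma>\<close> itself. The third bound combines V(x)^2 = (y^T x)^2
  <= |y|^2 |x|^2 with lambda_min(Gamma) |y|^2 <= V(x).\<close>

lemma inverse_form_bounds:
  fixes \<Gamma> P :: "real^'n^'n"
  assumes pd: "pd \<Gamma>" and inv: "\<Gamma> ** P = mat 1"
  defines "V \<equiv> \<lambda>x. x \<bullet> (P *v x)"
  shows "V x \<ge> 0"
    and "x \<bullet> x \<le> lambda_max \<Gamma> * V x"
    and "lambda_min \<Gamma> * V x \<le> x \<bullet> x"
    and "x \<bullet> x \<le> (lambda_max \<Gamma>)\<^sup>2 * ((P *v x) \<bullet> (P *v x))"
proof -
  define y where "y = P *v x"
  have x: "\<Gamma> *v y = x" by (simp add: y_def matrix_vector_mul_assoc inv)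
  have V: "V x = y \<bullet> (\<Gamma> *v y)" unfolding x by (simp add: V_def y_def inner_commute)
  have sym: "transpose \<Gamma> = \<Gamma>" using pd by (simp add: pd_def)
  have l: "lambda_min \<Gamma> > 0" "lambda_min \<Gamma> \<le> lambda_max \<Gamma>"
    using lambda_min_pos[OF pd] lambda_min_le_lambda_max[OF sym] .
  show V0: "V x \<ge> 0" unfolding V using pd_imp_psd[OF pd] by (simp add: psd_def)
  show xV: "x \<bullet> x \<le> lambda_max \<Gamma> * V x"
    using pd_image_norm_bound[OF pd, of y] unfolding V x .
  show "x \<bullet> x \<le> (lambda_max \<Gamma>)\<^sup>2 * ((P *v x) \<bullet> (P *v x))"
  proof -
    have "lambda_max \<Gamma> * V x \<le> lambda_max \<Gamma> * (lambda_max \<Gamma> * (y \<bullet> y))"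
      unfolding V using lambda_max_bound[OF sym, of y] l by (intro mult_left_mono) auto
    then show ?thesis using xV by (simp add: y_def power2_eq_square mult_ac)
  qed
  show "lambda_min \<Gamma> * V x \<le> x \<bullet> x"
  proof (cases "V x = 0")
    case False
    have "(V x)\<^sup>2 \<le> (y \<bullet> y) * (x \<bullet> x)"
      unfolding V x by (rule Cauchy_Schwarz_ineq)
    then have "lambda_min \<Gamma> * (V x)\<^sup>2 \<le> lambda_min \<Gamma> * ((y \<bullet> y) * (x \<bullet> x))"
      using l by (intro mult_left_mono) auto
    also have "\<dots> = (lambda_min \<Gamma> * (y \<bullet> y)) * (x \<bullet> x)" by simp
    also have "\<dots> \<le> V x * (x \<bullet> x)"
      unfolding V using lambda_min_bound(2)[OF sym, of y] by (intro mult_right_mono) auto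
    finally have "V x * (lambda_min \<Gamma> * V x) \<le> V x * (x \<bullet> x)"
      by (simp add: power2_eq_square mult_ac)
    then show ?thesis using V0 False by simp
  qed simp
qed

text \<open>Multiplying the radius condition by \<open>D\<close> covers both readings of the
  quotient, the left side being 0 when \<open>D = 0\<close>. The bound on \<open>\<epsilon>\<close>
  keeps \<open>D\<close> nonnegative, so the root is a genuine one.\<close>

lemma roa_radius_bound:
  assumes "0 < lambda_min \<Gamma>" "lambda_min \<Gamma> \<le> lambda_max \<Gamma>" "\<epsilon> \<le> lambda_min \<Gamma>"
    and "r > 0" and x: "x \<in> cball 0 (roa_radius \<Gamma> \<epsilon> r)"
  defines "D \<equiv> (lambda_max \<Gamma>)\<^sup>2 - \<epsilon> * lambda_min \<Gamma>"
  shows "D \<ge> 0" "norm x \<le> r" "D * (x \<bullet> x) \<le> lambda_max \<Gamma> * lambda_min \<Gamma> * r\<^sup>2"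
proof -
  let ?L = "lambda_max \<Gamma>" and ?l = "lambda_min \<Gamma>"
  have "\<epsilon> * ?l \<le> ?l * ?l" "?l * ?l \<le> ?L * ?L" using assms(1-3) by (auto intro: mult_mono)
  then show D: "D \<ge> 0" by (simp add: D_def power2_eq_square)
  show "norm x \<le> r" using x by (simp add: roa_radius_def Let_def split: if_splits)
  show "D * (x \<bullet> x) \<le> ?L * ?l * r\<^sup>2"
  proof (cases "D = 0")
    case False
    then have "norm x \<le> sqrt (?L * ?l / D) * r"
      using x by (simp add: roa_radius_def D_def)
    then have "(norm x)\<^sup>2 \<le> (sqrt (?L * ?l / D) * r)\<^sup>2" by (intro power_mono) auto
    also have "\<dots> = ?L * ?l / D * r\<^sup>2" using D assms(1,2) by (simp add: power_mult_distrib)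
    finally show ?thesis using False D by (simp add: power2_norm_eq_inner field_simps)
  qed (use assms(1,2) in simp)
qed

text \<open>
  The ball is not sublevel invariant, so each iterate is compared with the first one: the decrease
  from \<open>x0\<close> to \<open>f x0\<close> puts \<open>f x0\<close> into a sublevel set of the Lyapunov function that lies in the ball.
\<close>

lemma exp_convergent_from_lyapunov:
  fixes \<Gamma> P :: "real^'n^'n" and f :: "real^'n \<Rightarrow> real^'n"
  assumes pd: "pd \<Gamma>" and inv: "\<Gamma> ** P = mat 1" and r: "r > 0"
    and \<epsilon>: "\<epsilon> > 0" "\<epsilon> \<le> lambda_min \<Gamma>"
    and decrease: "\<And>x. x \<in> cball 0 r \<Longrightarrow> x \<in> ellipsoid P 1 \<Longrightarrow>
      f x \<bullet> (P *v f x) \<le> x \<bullet> (P *v x) - \<epsilon> * ((P *v x) \<bullet> (P *v x))"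
  shows "exp_convergent_from (cball 0 r) f (cball 0 (roa_radius \<Gamma> \<epsilon> r) \<inter> ellipsoid P 1)"
proof -
  define V where "V x = x \<bullet> (P *v x)" for x
  define L l where "L = lambda_max \<Gamma>" and "l = lambda_min \<Gamma>"
  define D where "D = L\<^sup>2 - \<epsilon> * l"
  have sym: "transpose \<Gamma> = \<Gamma>" using pd by (simp add: pd_def)
  have l: "l > 0" and lL: "l \<le> L" and L: "L > 0"
    using lambda_min_pos[OF pd] lambda_min_le_lambda_max[OF sym] by (auto simp: l_def L_def)
  note bounds = inverse_form_bounds[OF pd inv, folded V_def L_def l_def]
  have dec: "V (f x) \<le> V x - \<epsilon> * (x \<bullet> x) / L\<^sup>2" if "x \<in> cball 0 r" "V x \<le> 1" for x
  proof -
    have "(x \<bullet> x) / L\<^sup>2 \<le> (P *v x) \<bullet> (P *v x)"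
      using bounds(4)[of x] L by (simp add: field_simps)
    then have "\<epsilon> * ((x \<bullet> x) / L\<^sup>2) \<le> \<epsilon> * ((P *v x) \<bullet> (P *v x))"
      using \<epsilon> by (intro mult_left_mono) auto
    then show ?thesis using decrease[of x] that by (simp add: ellipsoid_def V_def)
  qed
  \<comment> \<open>D / L^2 = 1 - epsilon l / L^2 is the contraction factor of \<open>V\<close>,
    less than 1 but possibly 0; the maximum with 1/2 keeps the rate positive.\<close>
  define q where "q = max (1/2) (D / L\<^sup>2)"
  have q: "0 < q" "q < 1" using \<epsilon> l L by (auto simp: q_def D_def)
  have contract: "V (f x) \<le> q * V x" if "x \<in> cball 0 r" "V x \<le> 1" for x
  proof -
    have "\<epsilon> * (l * V x) / L\<^sup>2 \<le> \<epsilon> * (x \<bullet> x) / L\<^sup>2"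
      using bounds(3)[of x] \<epsilon> by (intro divide_right_mono mult_left_mono) auto
    then have "V (f x) \<le> V x - \<epsilon> * (l * V x) / L\<^sup>2" using dec[OF that] by linarith
    also have "\<dots> = D / L\<^sup>2 * V x" using L by (simp add: D_def field_simps)
    also have "\<dots> \<le> q * V x" using bounds(1)[of x] by (intro mult_right_mono) (auto simp: q_def)
    finally show ?thesis .
  qed
  have main: "(f ^^ k) x0 \<in> cball 0 r \<and> V ((f ^^ k) x0) \<le> q ^ k * V x0"
    if x0: "x0 \<in> cball 0 (roa_radius \<Gamma> \<epsilon> r) \<inter> ellipsoid P 1" for x0 k
  proof -
    have "x0 \<in> cball 0 (roa_radius \<Gamma> \<epsilon> r)" using x0 by blast
    from roa_radius_bound[OF _ _ \<epsilon>(2) r this, folded l_def L_def, folded D_def]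
    have x0r: "x0 \<in> cball 0 r" and Dx0: "D * (x0 \<bullet> x0) \<le> L * l * r\<^sup>2"
      using l lL by auto
    have V0: "V x0 \<le> 1" using x0 by (simp add: ellipsoid_def V_def)
    \<comment> \<open>Origin of the radius: |y|^2 <= L V(y) and V(f x0) <= (1/l - epsilon/L^2)
      |x0|^2 give |y|^2 <= D |x0|^2 / (L l), which the choice of the initial ball bounds by
      r^2.\<close>
    have in_ball: "y \<in> cball 0 r" if "V y \<le> V (f x0)" for y
    proof -
      have "V (f x0) \<le> V x0 - \<epsilon> * (x0 \<bullet> x0) / L\<^sup>2" using dec[OF x0r V0] .
      also have "V x0 \<le> (x0 \<bullet> x0) / l" using bounds(3)[of x0] l by (simp add: field_simps)
      finally have "V y \<le> (x0 \<bullet> x0) / l - \<epsilon> * (x0 \<bullet> x0) / L\<^sup>2" using that by simp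
      then have "L * V y \<le> L * ((x0 \<bullet> x0) / l - \<epsilon> * (x0 \<bullet> x0) / L\<^sup>2)"
        using L by (intro mult_left_mono) auto
      also have "\<dots> = D * (x0 \<bullet> x0) / (L * l)"
        using L l by (simp add: D_def field_simps power2_eq_square)
      also have "\<dots> \<le> r\<^sup>2" using Dx0 L l by (simp add: field_simps)
      finally have "(norm y)\<^sup>2 \<le> r\<^sup>2" using bounds(2)[of y] by (simp add: power2_norm_eq_inner)
      then show ?thesis using r by (simp add: power2_le_iff_abs_le)
    qed
    \<comment> \<open>The third conjunct starts at k = 1, since V(x0) itself may exceed V(f x0);
      through \<open>in_ball\<close> it puts the next iterate in the ball. The second keeps
      \<open>V\<close> at most 1, so the decrease remains applicable.\<close>
    have "(f ^^ k) x0 \<in> cball 0 r \<and> V ((f ^^ k) x0) \<le> q ^ k * V x0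
        \<and> (k > 0 \<longrightarrow> V ((f ^^ k) x0) \<le> V (f x0))"
    proof (induction k)
      case 0
      then show ?case using x0r by simp
    next
      case (Suc k)
      let ?y = "(f ^^ k) x0"
      have "q ^ k * V x0 \<le> 1 * V x0"
        using q bounds(1)[of x0] by (intro mult_right_mono) (auto intro: power_le_one)
      then have "V ?y \<le> 1" using Suc V0 by linarith
      then have step: "V (f ?y) \<le> q * V ?y" using contract Suc by blast
      also have "\<dots> \<le> q * (q ^ k * V x0)" using Suc q by (intro mult_left_mono) auto
      finally have decay: "V (f ?y) \<le> q ^ Suc k * V x0" by simp
      have "q * V ?y \<le> 1 * V ?y" using q bounds(1)[of ?y] by (intro mult_right_mono) auto
      then have "V (f ?y) \<le> V (f x0)" using step Suc by (cases "k = 0") auto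
      then show ?case using decay in_ball by simp
    qed
    then show ?thesis by blast
  qed
  \<comment> \<open>\<open>V\<close> lies between |x|^2 / L and |x|^2 / l, which yields the constant
    sqrt (L / l); as \<open>V\<close> is quadratic, the rate for the norm is the square root of
    \<open>q\<close>.\<close>
  have "norm ((f ^^ k) x0) \<le> sqrt (L / l) * sqrt q ^ k * norm x0"
    if x0: "x0 \<in> cball 0 (roa_radius \<Gamma> \<epsilon> r) \<inter> ellipsoid P 1" for x0 k
  proof (rule power2_le_imp_le)
    let ?y = "(f ^^ k) x0"
    have "(norm ?y)\<^sup>2 \<le> L * V ?y" using bounds(2)[of ?y] by (simp add: power2_norm_eq_inner)
    also have "\<dots> \<le> L * (q ^ k * V x0)" using main[OF x0] L by (intro mult_left_mono) auto
    also have "\<dots> \<le> L * (q ^ k * ((x0 \<bullet> x0) / l))"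
      using bounds(3)[of x0] L l q by (intro mult_left_mono) (auto simp: field_simps)
    also have "\<dots> = (sqrt (L / l) * sqrt q ^ k * norm x0)\<^sup>2"
    proof -
      have "(sqrt q ^ k)\<^sup>2 = q ^ k" using q by (simp flip: power_mult add: mult.commute[of k 2] power_mult)
      then show ?thesis using L l by (simp add: power_mult_distrib power2_norm_eq_inner)
    qed
    finally show "(norm ?y)\<^sup>2 \<le> (sqrt (L / l) * sqrt q ^ k * norm x0)\<^sup>2" .
  qed (use L l q in simp)
  moreover have "0 < sqrt (L / l)" "0 < sqrt q" "sqrt q < 1" using L l q by auto
  ultimately show ?thesis
    unfolding exp_convergent_from_def using main by meson
qed

lemma region_of_attraction_exp_convergent:
  assumes "exp_convergent_from X f R" "f 0 = 0"
  shows "region_of_attraction X f R"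
proof -
  obtain c \<rho> where \<rho>: "0 < \<rho>" "\<rho> < 1"
    and *: "\<And>x0 k. x0 \<in> R \<Longrightarrow> (f ^^ k) x0 \<in> X \<and> norm ((f ^^ k) x0) \<le> c * \<rho> ^ k * norm x0"
    using assms(1) unfolding exp_convergent_from_def by blast
  have "(\<lambda>k. (f ^^ k) x0) \<longlonglongrightarrow> 0" if "x0 \<in> R" for x0
  proof (rule Lim_null_comparison)
    show "\<forall>\<^sub>F k in sequentially. norm ((f ^^ k) x0) \<le> c * \<rho> ^ k * norm x0"
      using *[OF that] by simp
    have "(\<lambda>k. \<rho> ^ k) \<longlonglongrightarrow> 0" using \<rho> by (intro LIMSEQ_realpow_zero) auto
    then have "(\<lambda>k. c * \<rho> ^ k * norm x0) \<longlonglongrightarrow> c * 0 * norm x0" by (intro tendsto_mult tendsto_const)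
    then show "(\<lambda>k. c * \<rho> ^ k * norm x0) \<longlonglongrightarrow> 0" by simp
  qed
  then show ?thesis unfolding region_of_attraction_def using * assms(2) by blast
qed

section \<open>Closed-loop stability from the data-dependent matrix inequalities\<close>

theorem theorem6:
  fixes X :: "(real^'n) set"
    and A :: "real^'n \<Rightarrow> real^'n^'n" and B :: "real^'n \<Rightarrow> real^'m^'n"
    and ubar :: "real^'m"
    and blkA :: "'p::finite \<Rightarrow> 'n" and \<xi>A :: "real^'n \<Rightarrow> real^'p" and EA :: "real^'p^'n"
    and blkB :: "'q::finite \<Rightarrow> 'm" and \<xi>B :: "real^'n \<Rightarrow> real^'q" and EB :: "real^'q^'n"
    and T :: nat and tm :: "'t::finite \<Rightarrow> nat"
    and ud :: "nat \<Rightarrow> real^'m" and xd :: "nat \<Rightarrow> real^'n" and d :: "nat \<Rightarrow> real^'n"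
    and X0 :: "real^'t^'p" and X1 :: "real^'t^'n" and U0 :: "real^'t^'q" and D0 :: "real^'t^'n"
    and \<Theta> :: "real^'n^'n"
    and \<A> :: "real^('p + 'q)^('p + 'q)" and \<B> :: "real^('p + 'q)^'n" and \<C> :: "real^'n^'n"
    and r :: real
    and \<Gamma> :: "real^'n^'n" and \<epsilon> :: real and Y W :: "real^'n^'m" and S :: "real^'m^'m"
    and K :: "real^'n^'m" and P :: "real^'n^'n"
  assumes X_origin: "0 \<in> X"
    and A_cont: "\<And>i j. continuous_on X (\<lambda>x. A x $ i $ j)"
    and B_cont: "\<And>i j. continuous_on X (\<lambda>x. B x $ i $ j)"
    and ubar_pos: "\<And>i. ubar $ i > 0"
    and A1_cont: "continuous_on X \<xi>A" "continuous_on X \<xi>B"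
    and A1_A: "\<And>x j. x \<in> X \<Longrightarrow> column j (A x) = block_mult blkA EA (\<xi>A x) j"
    and A1_B: "\<And>x j. x \<in> X \<Longrightarrow> column j (B x) = block_mult blkB EB (\<xi>B x) j"
    and T_pos: "T \<ge> 1"
    and tm_bij: "bij_betw tm UNIV {..<T}"
    and data: "\<And>k. k < T \<Longrightarrow>
       xd (Suc k) = EA *v (blkdiag blkA (\<xi>A (xd k)) *v xd k)
                  + EB *v (blkdiag blkB (\<xi>B (xd k)) *v ud k) + d k"
    and X0_eq: "X0 = data_matrix tm (\<lambda>k. blkdiag blkA (\<xi>A (xd k)) *v xd k)"
    and X1_eq: "X1 = data_matrix tm (\<lambda>k. xd (Suc k))"
    and U0_eq: "U0 = data_matrix tm (\<lambda>k. blkdiag blkB (\<xi>B (xd k)) *v ud k)"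
    and D0_eq: "D0 = data_matrix tm d"
    and A2: "psd \<Theta>" "D0 ** transpose D0 \<preceq>\<^sub>L \<Theta>"
    and A3: "rank (vstack X0 U0) = CARD('p + 'q)"
    and \<A>_eq: "\<A> = vstack X0 U0 ** transpose (vstack X0 U0)"
    and \<B>_eq: "\<B> = - (X1 ** transpose (vstack X0 U0))"
    and \<C>_eq: "\<C> = X1 ** transpose X1 - \<Theta>"
    and r_pos: "r > 0" and r_ball: "cball 0 r \<subseteq> X"
    and \<Gamma>_pd: "pd \<Gamma>" and \<epsilon>_pos: "\<epsilon> > 0"
    and S_diag: "diagonal_matrix S" and S_pd: "pd S"
    and LMI_sat: "\<And>i. psd (block_mat \<Gamma>              (columnvector (row i W) :: real^1^'n)
                                      (rowvector (row i W)) (mat ((ubar $ i)\<^sup>2)))"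
    and LMI_data: "\<And>Q. Q \<in> vertex_set blkA \<xi>A blkB \<xi>B r \<Longrightarrow>
       block_mat
         (block_mat (- \<Gamma> + \<epsilon> *\<^sub>R mat 1) (- transpose Y - transpose W)
                    (- Y - W)               (- (2 *\<^sub>R S)))
         (block_mat (0 :: real^'n^'n) (transpose (vstack \<Gamma> Y) ** transpose Q)
                    0                 (transpose (vstack 0 S) ** transpose Q))
         (block_mat 0                  0
                    (Q ** vstack \<Gamma> Y) (Q ** vstack 0 S))
         (block_mat (- \<Gamma> - \<C>)      (- \<B>)
                    (- transpose \<B>) (- \<A>))
       \<preceq>\<^sub>L 0"
    and K_eq: "K = Y ** matrix_inv \<Gamma>" and P_eq: "P = matrix_inv \<Gamma>"
  shows "region_of_attraction X (\<lambda>x. A x *v x + B x *v sat ubar (K *v x))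
           (cball 0 (roa_radius \<Gamma> \<epsilon> r) \<inter> ellipsoid P 1)
       \<and> exp_convergent_from X (\<lambda>x. A x *v x + B x *v sat ubar (K *v x))
           (cball 0 (roa_radius \<Gamma> \<epsilon> r) \<inter> ellipsoid P 1)"
proof -
  let ?f = "\<lambda>x. A x *v x + B x *v sat ubar (K *v x)"
  let ?R = "cball 0 (roa_radius \<Gamma> \<epsilon> r) \<inter> ellipsoid P 1"
  \<comment> \<open>The data equation is available only for times below \<open>T\<close>, and these
    are exactly the column times.\<close>
  have "tm t < T" for t using tm_bij by (auto simp: bij_betw_def)
  then have "data_matrix tm (\<lambda>k. xd (Suc k)) = data_matrix tm (\<lambda>k. EA *v (blkdiag blkA (\<xi>A (xd k)) *v xd k)
                  + EB *v (blkdiag blkB (\<xi>B (xd k)) *v ud k) + d k)"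
    unfolding data_matrix_def by (simp only: data)
  then have X1: "X1 = EA ** X0 + EB ** U0 + D0"
    by (simp add: X1_eq X0_eq U0_eq D0_eq matrix_mult_data_matrix data_matrix_add)
  have cont: "continuous_on (cball 0 r) \<xi>A" "continuous_on (cball 0 r) \<xi>B"
    using A1_cont r_ball continuous_on_subset by blast+
  have inv: "\<Gamma> ** P = mat 1" unfolding P_eq by (rule pd_inverse[OF \<Gamma>_pd])
  have rows: "((W *v v) $ i)\<^sup>2 \<le> (ubar $ i)\<^sup>2 * (v \<bullet> (\<Gamma> *v v))" for i v
    using row_lmi_bound[OF LMI_sat, of i v]
    by (simp add: matrix_vector_mul_component row_def)
  \<comment> \<open>Here the unknown coefficients are eliminated: the inequality at the dominating
    vertex is tested with q = [EA EB]^T p, for which the data terms are nonpositive.\<close>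
  have form: "\<epsilon> * (v \<bullet> v) - v \<bullet> (\<Gamma> *v v) - 2 * (w \<bullet> (Y *v v + W *v v + S *v w))
      - p \<bullet> (\<Gamma> *v p) + 2 * (p \<bullet> (A x *v (\<Gamma> *v v) + B x *v (Y *v v + S *v w))) \<le> 0"
    if x: "x \<in> cball 0 r" for x v w p
  proof -
    have "x \<in> X" using x r_ball by blast
    have A: "A x = EA ** blkdiag blkA (\<xi>A x)" and B: "B x = EB ** blkdiag blkB (\<xi>B x)"
      using A1_A[OF \<open>x \<in> X\<close>] A1_B[OF \<open>x \<in> X\<close>] by (auto intro: eq_matrix_mult_blkdiag)
    let ?a = "\<Gamma> *v v" and ?b = "Y *v v + S *v w"
    let ?qA = "transpose EA *v p" and ?qB = "transpose EB *v p"
    obtain Q where Q: "Q \<in> vertex_set blkA \<xi>A blkB \<xi>B r"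
      "?qA \<bullet> (blkdiag blkA (\<xi>A x) *v ?a) + ?qB \<bullet> (blkdiag blkB (\<xi>B x) *v ?b)
        \<le> vjoin ?qA ?qB \<bullet> (Q *v vjoin ?a ?b)"
      using vertex_set_dominate[OF cont x] .
    have "p \<bullet> (A x *v ?a + B x *v ?b)
        = ?qA \<bullet> (blkdiag blkA (\<xi>A x) *v ?a) + ?qB \<bullet> (blkdiag blkB (\<xi>B x) *v ?b)"
      unfolding A B inner_add_right
      by (simp only: inner_matrix_vector[symmetric] matrix_vector_mul_assoc[symmetric])
    moreover have "p \<bullet> (\<C> *v p) + 2 * (p \<bullet> (\<B> *v vjoin ?qA ?qB))
        + vjoin ?qA ?qB \<bullet> (\<A> *v vjoin ?qA ?qB) \<le> 0"
      unfolding \<A>_eq \<B>_eq \<C>_eq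
      by (rule consistent_data_quadratic_form[OF X1 A2(2) refl])
    ultimately show ?thesis
      using data_lmi_quadratic_form[OF LMI_data[OF Q(1)], of v w p "vjoin ?qA ?qB"] Q(2)
      by linarith
  qed
  \<comment> \<open>With w = p = 0 the inequality says epsilon |v|^2 <= v^T Gamma v; evaluate it at
    an eigenvector for the least eigenvalue. The state 0 serves merely as a point of the
    ball.\<close>
  have \<epsilon>_le: "\<epsilon> \<le> lambda_min \<Gamma>"
  proof -
    have "transpose \<Gamma> = \<Gamma>" using \<Gamma>_pd by (simp add: pd_def)
    then obtain v where v: "v \<noteq> 0" "\<Gamma> *v v = lambda_min \<Gamma> *\<^sub>R v"
      using lambda_min_bound(1) unfolding eigenvalues_def by blast
    have "\<epsilon> * (v \<bullet> v) \<le> lambda_min \<Gamma> * (v \<bullet> v)"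
      using form[of 0 v 0 0] r_pos by (simp add: v(2))
    then show ?thesis using v(1) by (simp add: mult_le_cancel_right)
  qed
  have decrease: "?f x \<bullet> (P *v ?f x) \<le> x \<bullet> (P *v x) - \<epsilon> * ((P *v x) \<bullet> (P *v x))"
    if "x \<in> cball 0 r" "x \<in> ellipsoid P 1" for x
    using saturated_lyapunov_decrease[OF S_diag S_pd ubar_pos rows form[OF that(1)] inv that(2)]
    by (simp add: K_eq P_eq)
  have "exp_convergent_from (cball 0 r) ?f ?R"
    by (rule exp_convergent_from_lyapunov[OF \<Gamma>_pd inv r_pos \<epsilon>_pos \<epsilon>_le decrease])
  then have "exp_convergent_from X ?f ?R"
    unfolding exp_convergent_from_def using r_ball by (meson subsetD)
  moreover have "sat ubar 0 = 0" by (simp add: vec_eq_iff sat_def)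
  then have "?f 0 = 0" by simp
  ultimately show ?thesis using region_of_attraction_exp_convergent by blast
qed

end
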